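(* Let $G$ be a hidden graph on vertex set $V$ accessible via a separation oracle, and let $S\subseteq V$. The connected components of $G[S]$ can be computed with $\mathcal{O}(|S|^2)$ separation queries, and there are instances where $\Omega(|S|^2)$ separation queries are needed.
   Context: The separation oracle, on input $(v,w,U)$ with $v\neq w$ and $U\subseteq V\setminus\{v,w\}$, returns Yes if $v$ and $w$ are in different connected components of the induced subgraph $G[V\setminus U]$, and No otherwise. Computing the connected components of $G[S]$ means outputting the partition of $S$ into the vertex sets of the connected components of $G[S]$, guaranteed correct from the query answers alone. *)

theory Defs
  imports Complex_Main "Graph_Theory.Digraph_Component"
begin

text \<open>
  Finite simple undirected graphs are the symmetric loop-free pair digraphs of \<^locale>\<open>pair_graph\<close>
  (an undirected edge is a pair of opposite arcs). In a symmetric digraph the strongly connected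
  components are exactly the connected components.
\<close>

definition graph_on :: "'v set \<Rightarrow> 'v pair_pre_digraph \<Rightarrow> bool" where
  "graph_on V G \<longleftrightarrow> pair_graph G \<and> pverts G = V"

definition components :: "'v pair_pre_digraph \<Rightarrow> 'v set \<Rightarrow> 'v set set" where
  "components G S = pre_digraph.sccs_verts (with_proj G \<restriction> S)"

text \<open>Only meaningful for \<open>S \<subseteq> pverts G\<close>, since the vertex set of \<open>with_proj G \<restriction> S\<close> is \<open>S\<close>.\<close>

definition valid_query :: "'v set \<Rightarrow> 'v \<Rightarrow> 'v \<Rightarrow> 'v set \<Rightarrow> bool" where
  "valid_query V v w U \<longleftrightarrow> v \<in> V \<and> w \<in> V \<and> v \<noteq> w \<and> U \<subseteq> V - {v, w}"

definition separation_oracle :: "'v pair_pre_digraph \<Rightarrow> 'v \<Rightarrow> 'v \<Rightarrow> 'v set \<Rightarrow> bool" where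
  "separation_oracle G v w U \<longleftrightarrow>
     (\<exists>A \<in> components G (pverts G - U). \<exists>B \<in> components G (pverts G - U).
        v \<in> A \<and> w \<in> B \<and> A \<noteq> B)"

text \<open>
  A deterministic adaptive query algorithm is a decision tree: \<open>Query v w U A B\<close> asks the oracle
  about \<open>(v, w, U)\<close> and continues with \<open>A\<close> on answer Yes and with \<open>B\<close> on answer No. The hidden
  graph influences a run only through the answers.
\<close>

datatype 'v algorithm =
    Output "'v set set"
  | Query 'v 'v "'v set" "'v algorithm" "'v algorithm"

primrec valid_algorithm :: "'v set \<Rightarrow> 'v algorithm \<Rightarrow> bool" where
  "valid_algorithm V (Output P) \<longleftrightarrow> True"
| "valid_algorithm V (Query v w U A B) \<longleftrightarrow>
     valid_query V v w U \<and> valid_algorithm V A \<and> valid_algorithm V B"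

primrec result :: "'v algorithm \<Rightarrow> 'v pair_pre_digraph \<Rightarrow> 'v set set" where
  "result (Output P) G = P"
| "result (Query v w U A B) G = (if separation_oracle G v w U then result A G else result B G)"

primrec num_queries :: "'v algorithm \<Rightarrow> 'v pair_pre_digraph \<Rightarrow> nat" where
  "num_queries (Output P) G = 0"
| "num_queries (Query v w U A B) G =
     Suc (if separation_oracle G v w U then num_queries A G else num_queries B G)"

text \<open>The algorithm may depend on \<open>V\<close> and \<open>S\<close>, but has to be correct for every hidden graph on \<open>V\<close>.\<close>

definition computes_components :: "'v set \<Rightarrow> 'v set \<Rightarrow> 'v algorithm \<Rightarrow> bool" where
  "computes_components V S A \<longleftrightarrow>
     valid_algorithm V A \<and> (\<forall>G. graph_on V G \<longrightarrow> result A G = components G S)"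

end

theory Submission
  imports Defs
begin

text \<open>
  Upper bound: for distinct \<open>v, w \<in> S\<close> the query \<open>(v, w, V - S)\<close> tells whether \<open>v\<close> and \<open>w\<close>
  lie in different components of \<open>G[S]\<close>, so asking all pairs determines the components.
  Lower bound: take \<open>S = V\<close> and the graph without edges. Adding the single edge \<open>{x, y}\<close>
  changes only the answers to queries about the pair \<open>{x, y}\<close>, yet it changes the components;
  hence on the edgeless graph a correct algorithm must query every pair.
\<close>

lemma graph_on_induce:
  assumes "graph_on V G" "S \<subseteq> V"
  shows "wf_digraph (with_proj G \<restriction> S)" "symmetric (with_proj G \<restriction> S)"
proof -
  interpret pair_graph G using assms by (simp add: graph_on_def)
  show "wf_digraph (with_proj G \<restriction> S)"
    by (rule wellformed_induce_subgraph)
  show "symmetric (with_proj G \<restriction> S)"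
    using pair_sym_arcs by (auto simp: symmetric_def sym_def arcs_ends_conv)
qed

text \<open>Symmetry of the arcs makes one-way reachability mutual, so a strong component is the
  forward reachability class of any of its vertices.\<close>

lemma components_eq:
  assumes "graph_on V G" "S \<subseteq> V"
  shows "components G S = (\<lambda>u. {v. u \<rightarrow>\<^sup>*\<^bsub>with_proj G \<restriction> S\<^esub> v}) ` S"
proof -
  interpret H: wf_digraph "with_proj G \<restriction> S" by (rule graph_on_induce[OF assms])
  have "H.scc_of u = {v. u \<rightarrow>\<^sup>*\<^bsub>with_proj G \<restriction> S\<^esub> v}" for u
    unfolding H.scc_of_def using symmetric_reachable[OF graph_on_induce(2)[OF assms]] by blast
  then show ?thesis
    unfolding components_def H.sccs_verts_conv_scc_of by simp
qed

text \<open>Reachability in the induced subgraph is an equivalence relation, so the only components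
  that can contain \<open>v\<close> and \<open>w\<close> are their own classes, and these differ
  exactly when no path joins them.\<close>

lemma separation_oracle_iff:
  assumes "graph_on V G" "v \<in> V - U" "w \<in> V - U"
  shows "separation_oracle G v w U \<longleftrightarrow> \<not> v \<rightarrow>\<^sup>*\<^bsub>with_proj G \<restriction> (V - U)\<^esub> w"
proof -
  let ?H = "with_proj G \<restriction> (V - U)"
  have V: "pverts G = V" using assms by (simp add: graph_on_def)
  interpret H: wf_digraph ?H by (rule graph_on_induce[OF assms(1)]) simp
  have sym: "a \<rightarrow>\<^sup>*\<^bsub>?H\<^esub> b \<Longrightarrow> b \<rightarrow>\<^sup>*\<^bsub>?H\<^esub> a" for a b
    by (rule symmetric_reachable[OF graph_on_induce(2)[OF assms(1) Diff_subset]])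
  have class_eq: "{c. a \<rightarrow>\<^sup>*\<^bsub>?H\<^esub> c} = {c. b \<rightarrow>\<^sup>*\<^bsub>?H\<^esub> c}" if "a \<rightarrow>\<^sup>*\<^bsub>?H\<^esub> b" for a b
    using that sym H.reachable_trans by blast
  have refl: "a \<rightarrow>\<^sup>*\<^bsub>?H\<^esub> a" if "a \<in> V - U" for a
    using that by simp
  have "separation_oracle G v w U \<longleftrightarrow>
    (\<exists>a\<in>V - U. \<exists>b\<in>V - U. a \<rightarrow>\<^sup>*\<^bsub>?H\<^esub> v \<and> b \<rightarrow>\<^sup>*\<^bsub>?H\<^esub> w
        \<and> {c. a \<rightarrow>\<^sup>*\<^bsub>?H\<^esub> c} \<noteq> {c. b \<rightarrow>\<^sup>*\<^bsub>?H\<^esub> c})"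
    unfolding separation_oracle_def V components_eq[OF assms(1) Diff_subset] by simp
  also have "\<dots> \<longleftrightarrow> {c. v \<rightarrow>\<^sup>*\<^bsub>?H\<^esub> c} \<noteq> {c. w \<rightarrow>\<^sup>*\<^bsub>?H\<^esub> c}"
    using class_eq refl assms(2,3) by metis
  also have "\<dots> \<longleftrightarrow> \<not> v \<rightarrow>\<^sup>*\<^bsub>?H\<^esub> w"
    using class_eq refl[OF assms(3)] by blast
  finally show ?thesis .
qed

text \<open>A non-adaptive algorithm: both answers lead to the same remaining queries.
  \<open>R\<close> accumulates the pairs answered No, that is, the connected ones, and only the
  output \<open>f R\<close> depends on it.\<close>

primrec ask_all :: "'v set \<Rightarrow> (('v \<times> 'v) set \<Rightarrow> 'v set set) \<Rightarrow> ('v \<times> 'v) list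
    \<Rightarrow> ('v \<times> 'v) set \<Rightarrow> 'v algorithm" where
  "ask_all U f [] R = Output (f R)"
| "ask_all U f (p # ps) R =
     Query (fst p) (snd p) U (ask_all U f ps R) (ask_all U f ps (insert p R))"

lemma valid_ask_all:
  assumes "\<forall>(v, w) \<in> set ps. valid_query V v w U"
  shows "valid_algorithm V (ask_all U f ps R)"
  using assms by (induction ps arbitrary: R) auto

lemma num_queries_ask_all: "num_queries (ask_all U f ps R) G = length ps"
  by (induction ps arbitrary: R) auto

lemma result_ask_all:
  "result (ask_all U f ps R) G = f (R \<union> {(v, w) \<in> set ps. \<not> separation_oracle G v w U})"
proof (induction ps arbitrary: R)
  case (Cons p ps)
  show ?case
    by (auto simp: Cons.IH intro!: arg_cong[where f = f])
qed simp

lemma upper_bound: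
  assumes "finite V" "S \<subseteq> V"
  obtains A where "computes_components V S A" "\<And>G. num_queries A G \<le> (card S)\<^sup>2"
proof -
  have fin: "finite S" using assms finite_subset by blast
  \<comment> \<open>Ordered pairs let the No answers be read directly as a relation, at the cost of
    a factor 2. The diagonal is left out because a valid query has distinct endpoints.\<close>
  obtain ps where ps: "set ps = S \<times> S - Id" "distinct ps"
    using finite_distinct_list fin by (metis finite_Diff finite_cartesian_product)
  \<comment> \<open>The class of \<open>v\<close> is read off from \<open>R\<close>; the disjunct
    \<open>v = w\<close> restores the diagonal that was never queried.\<close>
  define f where "f R = (\<lambda>v. {w \<in> S. v = w \<or> (v, w) \<in> R}) ` S" for R :: "('a \<times> 'a) set"
  define A where "A = ask_all (V - S) f ps {}"
  have "\<forall>(v, w) \<in> set ps. valid_query V v w (V - S)"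
    using assms by (auto simp: ps valid_query_def)
  then have valid: "valid_algorithm V A"
    unfolding A_def by (rule valid_ask_all)
  have correct: "result A G = components G S" if G: "graph_on V G" for G
  proof -
    interpret H: wf_digraph "with_proj G \<restriction> S" by (rule graph_on_induce[OF G assms(2)])
    \<comment> \<open>Deleting \<open>V - S\<close> from \<open>V\<close> leaves exactly
      \<open>S\<close>.\<close>
    have separated: "separation_oracle G v w (V - S) \<longleftrightarrow> \<not> v \<rightarrow>\<^sup>*\<^bsub>with_proj G \<restriction> S\<^esub> w"
      if "v \<in> S" "w \<in> S" for v w
      using separation_oracle_iff[OF G, of v "V - S" w] that assms(2)
      by (simp add: double_diff subset_iff)
    have "{w \<in> S. v = w \<or> (v, w) \<in> {(v, w) \<in> set ps. \<not> separation_oracle G v w (V - S)}}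
      = {w. v \<rightarrow>\<^sup>*\<^bsub>with_proj G \<restriction> S\<^esub> w}" if "v \<in> S" for v
    proof -
      have "w \<in> S" if "v \<rightarrow>\<^sup>*\<^bsub>with_proj G \<restriction> S\<^esub> w" for w
        using H.reachable_in_verts(2)[OF that] by simp
      moreover have "v \<rightarrow>\<^sup>*\<^bsub>with_proj G \<restriction> S\<^esub> v"
        using that by simp
      ultimately show ?thesis
        using separated[OF that] that by (auto simp: ps)
    qed
    then show ?thesis
      unfolding A_def result_ask_all components_eq[OF G assms(2)] f_def Un_empty_left
      by (rule image_cong[OF refl])
  qed
  have "length ps = card (S \<times> S - Id)"
    using ps distinct_card by metis
  also have "\<dots> \<le> card (S \<times> S)"
    using fin by (intro card_mono) auto
  finally have "num_queries A G \<le> (card S)\<^sup>2" for G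
    by (simp add: A_def num_queries_ask_all card_cartesian_product power2_eq_square)
  then show thesis
    using that valid correct by (auto simp: computes_components_def)
qed

text \<open>The pairs queried along the branch followed on \<open>G\<close>. They are unordered and
  \<open>U\<close> is dropped because neither affects the answers on the graphs of the lower
  bound.\<close>

primrec asked_pairs :: "'v algorithm \<Rightarrow> 'v pair_pre_digraph \<Rightarrow> 'v set set" where
  "asked_pairs (Output P) G = {}"
| "asked_pairs (Query v w U A B) G =
     insert {v, w} (if separation_oracle G v w U then asked_pairs A G else asked_pairs B G)"

lemma card_asked_pairs:
  "finite (asked_pairs A G) \<and> card (asked_pairs A G) \<le> num_queries A G"
  by (induction A) (auto simp: card_insert_if)

text \<open>If the answers agree along the branch taken on \<open>G\<close>, then \<open>H\<close>
  follows the same branch to the same leaf.\<close>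

lemma result_cong:
  assumes "valid_algorithm V A"
    and "\<And>v w U. \<lbrakk>valid_query V v w U; {v, w} \<in> asked_pairs A G\<rbrakk>
           \<Longrightarrow> separation_oracle G v w U = separation_oracle H v w U"
  shows "result A G = result A H"
  using assms by (induction A) (auto split: if_splits)

definition edge_graph :: "'v set \<Rightarrow> 'v rel \<Rightarrow> 'v pair_pre_digraph" where
  "edge_graph V E = \<lparr> pverts = V, parcs = E \<rparr>"

lemma graph_on_edge_graph:
  assumes "finite V" "E \<subseteq> V \<times> V" "sym E" "irrefl E"
  shows "graph_on V (edge_graph V E)"
proof -
  have "finite E" using assms finite_subset by blast
  with assms show ?thesis
    unfolding graph_on_def edge_graph_def
    by (auto intro!: pair_graph.intro pair_digraph.intro pair_pseudo_graph.intro
        pair_fin_digraph.intro pair_fin_digraph_axioms.intro pair_sym_digraph.intro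
        pair_sym_digraph_axioms.intro pair_loopfree_digraph.intro
        pair_loopfree_digraph_axioms.intro pair_wf_digraph.intro
        simp: symmetric_def irrefl_def)
qed

text \<open>The condition on \<open>E O E\<close> makes every component a clique. A path avoiding
  \<open>U\<close> then shortcuts to a single edge or is closed, so the answer does not depend on
  \<open>U\<close>. This covers both the edgeless graph and a single edge.\<close>

lemma separation_oracle_edge_graph:
  assumes "graph_on V (edge_graph V E)" "E O E \<subseteq> E \<union> Id" "valid_query V v w U"
  shows "separation_oracle (edge_graph V E) v w U \<longleftrightarrow> (v, w) \<notin> E"
proof -
  let ?H = "with_proj (edge_graph V E) \<restriction> (V - U)"
  have arcs: "arcs_ends ?H = {(a, b) \<in> E. a \<in> V - U \<and> b \<in> V - U}"
    by (auto simp: edge_graph_def arcs_ends_conv image_iff)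
  interpret H: wf_digraph ?H by (rule graph_on_induce[OF assms(1)]) simp
  have vw: "v \<in> V - U" "w \<in> V - U" "v \<noteq> w"
    using assms(3) by (auto simp: valid_query_def)
  have "a = b \<or> (a, b) \<in> E" if "a \<rightarrow>\<^sup>*\<^bsub>?H\<^esub> b" for a b
    using that
  proof (induction rule: H.reachable_induct)
    case (step b c)
    then have "(b, c) \<in> E" by (simp add: arcs)
    with step.IH assms(2) show ?case by blast
  qed simp
  moreover have "v \<rightarrow>\<^sup>*\<^bsub>?H\<^esub> w" if "(v, w) \<in> E"
    using that vw arcs by (intro H.reachable_adjI) auto
  ultimately show ?thesis
    using separation_oracle_iff[OF assms(1)] vw by blast
qed

lemma asks_every_pair:
  assumes "finite V" "computes_components V V A" "x \<in> V" "y \<in> V" "x \<noteq> y"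
  shows "{x, y} \<in> asked_pairs A (edge_graph V {})"
proof (rule ccontr)
  assume not_asked: "{x, y} \<notin> asked_pairs A (edge_graph V {})"
  define G where "G = edge_graph V {}"
  define H where "H = edge_graph V {(x, y), (y, x)}"
  have graphs: "graph_on V G" "graph_on V H"
    unfolding G_def H_def using assms
    by (auto intro!: graph_on_edge_graph simp: sym_def irrefl_def)
  have oracle_G: "separation_oracle G v w U" if "valid_query V v w U" for v w U
    using separation_oracle_edge_graph[OF graphs(1)[unfolded G_def] _ that] by (simp add: G_def)
  have oracle_H: "separation_oracle H v w U \<longleftrightarrow> {v, w} \<noteq> {x, y}" if "valid_query V v w U" for v w U
    using separation_oracle_edge_graph[OF graphs(2)[unfolded H_def] _ that]
    by (auto simp: H_def doubleton_eq_iff)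
  have "result A G = result A H"
    using assms(2) not_asked oracle_G oracle_H
    by (intro result_cong) (auto simp: computes_components_def G_def)
  then have "components G V = components H V"
    using assms(2) graphs by (simp add: computes_components_def)
  \<comment> \<open>With \<open>U\<close> empty the oracle is determined by the components of the
    whole graph, so equal components would force equal answers on the pair that \<open>H\<close>
    joins and \<open>G\<close> does not.\<close>
  then have "separation_oracle G x y {} \<longleftrightarrow> separation_oracle H x y {}"
    using graphs by (simp add: separation_oracle_def graph_on_def)
  moreover have "valid_query V x y {}"
    using assms by (simp add: valid_query_def)
  ultimately show False
    using oracle_G oracle_H by blast
qed

text \<open>Each query accounts for only one unordered pair, and all two-element subsets of
  \<open>V\<close> must occur among the asked pairs.\<close>

lemma lower_bound:
  assumes "finite V" "computes_components V V A"
  shows "card V choose 2 \<le> num_queries A (edge_graph V {})"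
proof -
  let ?Q = "asked_pairs A (edge_graph V {})"
  have "{K. K \<subseteq> V \<and> card K = 2} \<subseteq> ?Q"
    using asks_every_pair[OF assms] by (auto simp: card_2_iff)
  then have "card {K. K \<subseteq> V \<and> card K = 2} \<le> card ?Q"
    using card_asked_pairs card_mono by blast
  then show ?thesis
    using n_subsets[OF assms(1)] card_asked_pairs le_trans by metis
qed

lemma real_choose_two: "real (n choose 2) = real n * (real n - 1) / 2"
  by (induction n) (simp_all add: numeral_2_eq_2 field_simps)

theorem theorem18:
  assumes "infinite (UNIV :: 'v set)"
  shows "(\<exists>C::real. \<forall>(V :: 'v set) S. finite V \<and> S \<subseteq> V \<longrightarrow>
            (\<exists>A. computes_components V S A \<and>
               (\<forall>G. graph_on V G \<longrightarrow> real (num_queries A G) \<le> C * (real (card S))\<^sup>2)))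
       \<and> (\<exists>c::real. c > 0 \<and> (\<exists>N::nat. \<forall>n\<ge>N.
            \<exists>(V :: 'v set) S G. finite V \<and> S \<subseteq> V \<and> card S = n \<and> graph_on V G \<and>
              (\<forall>A. computes_components V S A \<longrightarrow> real (num_queries A G) \<ge> c * (real n)\<^sup>2)))"
proof (rule conjI)
  show "\<exists>C::real. \<forall>(V :: 'v set) S. finite V \<and> S \<subseteq> V \<longrightarrow>
            (\<exists>A. computes_components V S A \<and>
               (\<forall>G. graph_on V G \<longrightarrow> real (num_queries A G) \<le> C * (real (card S))\<^sup>2))"
  proof (intro exI[of _ 1] allI impI)
    fix V S :: "'v set"
    assume VS: "finite V \<and> S \<subseteq> V"
    obtain A where "computes_components V S A" "\<And>G. num_queries A G \<le> (card S)\<^sup>2"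
      using upper_bound VS by metis
    then show "\<exists>A. computes_components V S A \<and>
        (\<forall>G. graph_on V G \<longrightarrow> real (num_queries A G) \<le> 1 * (real (card S))\<^sup>2)"
      by (metis mult_1 of_nat_le_iff of_nat_power)
  qed
next
  show "\<exists>c::real. c > 0 \<and> (\<exists>N::nat. \<forall>n\<ge>N.
            \<exists>(V :: 'v set) S G. finite V \<and> S \<subseteq> V \<and> card S = n \<and> graph_on V G \<and>
              (\<forall>A. computes_components V S A \<longrightarrow> real (num_queries A G) \<ge> c * (real n)\<^sup>2))"
  \<comment> \<open>The bound \<open>n * (n - 1) / 2 \<ge> n\<^sup>2 / 4\<close> amounts to
    \<open>2 * n \<le> n\<^sup>2\<close>, which holds from \<open>n = 2\<close> on.\<close>
  proof (intro exI[of _ "1 / 4"] conjI exI[of _ 2] allI impI)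
    show "(1 / 4 :: real) > 0" by simp
  next
    fix n :: nat
    assume n: "n \<ge> 2"
    \<comment> \<open>An infinite vertex type supplies vertex sets of every size; the hard instance
      is the edgeless graph with \<open>S = V\<close>.\<close>
    obtain V :: "'v set" where V: "finite V" "card V = n"
      using infinite_arbitrarily_large[OF assms] by blast
    have "graph_on V (edge_graph V {})"
      using V by (intro graph_on_edge_graph) (auto simp: sym_def irrefl_def)
    moreover have "1 / 4 * (real n)\<^sup>2 \<le> real (num_queries A (edge_graph V {}))"
      if "computes_components V V A" for A
    proof -
      have "real n * 2 \<le> real n * real n"
        using n by (intro mult_left_mono) auto
      then have "1 / 4 * (real n)\<^sup>2 \<le> real (n choose 2)"
        by (simp add: real_choose_two power2_eq_square field_simps)
      also have "\<dots> \<le> real (num_queries A (edge_graph V {}))"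
        using lower_bound[OF V(1) that] V(2) by simp
      finally show ?thesis .
    qed
    ultimately show "\<exists>(V :: 'v set) S G. finite V \<and> S \<subseteq> V \<and> card S = n \<and> graph_on V G \<and>
        (\<forall>A. computes_components V S A \<longrightarrow> real (num_queries A G) \<ge> 1 / 4 * (real n)\<^sup>2)"
      using V by blast
  qed
qed

end
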